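(* For any family $\mathcal{F}=\{T_n \mid n\in\mathbb{N}\}$, where $T_n$ is a spanning tree of the $n\times n$ grid graph $G(n)$ for each $n$, $$\mathrm{Prob}_{\mathrm{MST}}(T_n)\;\geq\;\left(\tfrac14+o(1)\right)^{n^2}\quad\text{and}\quad \mathrm{Prob}_{\mathrm{MST}}(T_n)\;\leq\;\left(\tfrac12+o(1)\right)^{n^2}\qquad (n\to\infty);$$ equivalently, $$\liminf_{n\to\infty}\frac{\ln \mathrm{Prob}_{\mathrm{MST}}(T_n)}{n^2}\geq \ln\tfrac14\quad\text{and}\quad \limsup_{n\to\infty}\frac{\ln \mathrm{Prob}_{\mathrm{MST}}(T_n)}{n^2}\leq \ln\tfrac12 .$$
   Context: $G(n)$ denotes the $n\times n$ square grid graph: $n^2$ vertices $\{1,\dots,n\}^2$, with two vertices adjacent iff they are at Euclidean distance $1$. For a finite connected graph $G$ and a spanning tree $T$ of $G$, $\mathrm{Prob}_{\mathrm{MST}}(T)$ denotes the probability that $T$ is the output of the following random algorithm: order the edges of $G$ uniformly at random, start with the empty edge set, and go through the edges in that order, adding each edge unless it would create a cycle with the edges already added. (Equivalently, $T$ is the minimum spanning tree of $G$ for i.i.d. uniform $[0,1]$ edge weights.) *)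

theory Defs
  imports "HOL-Probability.Probability" "HOL-Combinatorics.Multiset_Permutations"
begin

text \<open>
  A finite simple graph is given by a vertex set \<open>V\<close> and a set \<open>E\<close> of undirected edges, each of
  them a two-element subset of \<open>V\<close>. A spanning tree has the vertex set of the ambient graph, so it
  is identified with its edge set. The notion of spanning tree in the AFP entry Graph_Theory does
  not fit: it is about directed graphs, where the two arcs of a symmetric edge already form a cycle.
\<close>

text \<open>
  A cycle is represented by its vertices \<open>p ! 0, \<dots>, p ! (k - 1)\<close> in cyclic order; they are distinct
  and \<open>k \<ge> 3\<close>, so that going back and forth along one edge is not a cycle.
\<close>

definition is_cycle :: "'a set set \<Rightarrow> 'a list \<Rightarrow> bool" where
  "is_cycle E p \<longleftrightarrow> 3 \<le> length p \<and> distinct p \<and>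
     (\<forall>i < length p. {p ! i, p ! (Suc i mod length p)} \<in> E)"

definition has_cycle :: "'a set set \<Rightarrow> bool" where
  "has_cycle E \<longleftrightarrow> (\<exists>p. is_cycle E p)"

definition connected_graph :: "'a set \<Rightarrow> 'a set set \<Rightarrow> bool" where
  "connected_graph V E \<longleftrightarrow> (\<forall>u\<in>V. \<forall>v\<in>V. (u, v) \<in> {(x, y). {x, y} \<in> E}\<^sup>*)"

definition spanning_tree :: "'a set \<Rightarrow> 'a set set \<Rightarrow> 'a set set \<Rightarrow> bool" where
  "spanning_tree V E T \<longleftrightarrow> T \<subseteq> E \<and> connected_graph V T \<and> \<not> has_cycle T"

definition kruskal_step :: "'a set set \<Rightarrow> 'a set \<Rightarrow> 'a set set" where
  "kruskal_step F e = (if has_cycle (insert e F) then F else insert e F)"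

definition kruskal :: "'a set list \<Rightarrow> 'a set set" where
  "kruskal es = foldl kruskal_step {} es"

text \<open>
  \<^const>\<open>permutations_of_set\<close> is the set of all duplicate-free lists enumerating \<open>E\<close>; it is finite
  and nonempty, so that \<^const>\<open>pmf_of_set\<close> is meaningful, because \<open>E\<close> is finite.
\<close>

definition prob_MST :: "'a set set \<Rightarrow> 'a set set \<Rightarrow> real" where
  "prob_MST E T = measure_pmf.prob (pmf_of_set (permutations_of_set E)) {es. kruskal es = T}"

definition grid_verts :: "nat \<Rightarrow> (nat \<times> nat) set" where
  "grid_verts n = {1..n} \<times> {1..n}"

text \<open>The distance on \<^typ>\<open>real \<times> real\<close> is the Euclidean one.\<close>

definition grid_edges :: "nat \<Rightarrow> (nat \<times> nat) set set" where
  "grid_edges n = {{(a, b), (c, d)} | a b c d.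
     (a, b) \<in> grid_verts n \<and> (c, d) \<in> grid_verts n \<and>
     dist (real a, real b) (real c, real d) = 1}"

lemma finite_grid_edges: "finite (grid_edges n)"
proof (rule finite_subset)
  show "grid_edges n \<subseteq> Pow (grid_verts n)"
    by (auto simp: grid_edges_def)
  show "finite (Pow (grid_verts n))"
    by (simp add: grid_verts_def)
qed

end

theory Submission
  imports Defs "HOL-Real_Asymp.Real_Asymp"
begin

text \<open>
  Lower bound: the output is \<open>T\<close> as soon as the edges of \<open>T\<close> precede all other edges, which has
  probability \<open>1 / (m choose card T) \<ge> 2 ^ -m\<close> for a graph with \<open>m\<close> edges, and \<open>m \<le> 2 n\<^sup>2\<close>.

  Upper bound: when the current forest still misses \<open>t\<close> edges of \<open>T\<close>, the next accepted edge is
  uniform among the edges joining two different components. There are \<open>t + 1\<close> components. The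
  rightmost vertex of a component has its right edge leaving the component, unless it lies on the
  right border of the grid, and likewise for the topmost vertex. Hence there are at least
  \<open>2 (t + 1 - n)\<close> such edges, and multiplying the conditional probabilities that an edge of \<open>T\<close> is
  accepted gives at most \<open>(2 n\<^sup>2) ^ n / 2 ^ n\<^sup>2\<close>.
\<close>

section \<open>Reachability and cycles\<close>

text \<open>Taken over the whole type, so that it is an equivalence relation without side conditions
  on vertices; it is the relation inside \<open>connected_graph\<close>.\<close>

definition reach :: "'a set set \<Rightarrow> ('a \<times> 'a) set" where
  "reach F = {(x, y). {x, y} \<in> F}\<^sup>*"

lemma equiv_reach: "equiv UNIV (reach F)"
proof (rule equivI)
  have "sym {(x, y). {x, y} \<in> F}"
    by (auto simp: sym_def insert_commute)
  then show "sym (reach F)"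
    unfolding reach_def by (rule sym_rtrancl)
qed (auto simp: reach_def refl_rtrancl trans_rtrancl)

lemma reach_refl [simp]: "(x, x) \<in> reach F"
  by (simp add: reach_def)

lemma reach_sym: "(x, y) \<in> reach F \<Longrightarrow> (y, x) \<in> reach F"
  using equiv_reach[of F] by (auto elim!: equivE dest: symD)

lemma reach_trans: "(x, y) \<in> reach F \<Longrightarrow> (y, z) \<in> reach F \<Longrightarrow> (x, z) \<in> reach F"
  by (auto simp: reach_def)

lemma reach_edge: "{x, y} \<in> F \<Longrightarrow> (x, y) \<in> reach F"
  by (auto simp: reach_def)

lemma reach_mono: "F \<subseteq> G \<Longrightarrow> reach F \<subseteq> reach G"
  unfolding reach_def by (rule rtrancl_mono) auto

lemma reach_Image_eq_iff: "reach F `` {x} = reach F `` {y} \<longleftrightarrow> (x, y) \<in> reach F"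
  using eq_equiv_class_iff[OF equiv_reach, of x y F] by simp

text \<open>Taking images under \<open>reach G\<close> sends the \<open>F\<close>-component of a
  vertex to its \<open>G\<close>-component. This map between components drives the counting
  arguments.\<close>

lemma reach_Image_Image:
  assumes "F \<subseteq> G"
  shows "reach G `` (reach F `` {v}) = reach G `` {v}"
proof
  show "reach G `` (reach F `` {v}) \<subseteq> reach G `` {v}"
  proof
    fix y assume "y \<in> reach G `` (reach F `` {v})"
    then obtain w where "(v, w) \<in> reach F" "(w, y) \<in> reach G" by blast
    with reach_mono[OF assms] show "y \<in> reach G `` {v}"
      using reach_trans[of v w G y] by blast
  qed
  show "reach G `` {v} \<subseteq> reach G `` (reach F `` {v})"
    by (intro Image_mono) auto
qed

text \<open>Induction along the walk: a second use of the new edge leads back to an endpoint already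
  attached, so one use in one direction suffices.\<close>

lemma reach_insertD:
  assumes "(x, y) \<in> reach (insert {u, v} F)"
  shows "(x, y) \<in> reach F \<or> (x, u) \<in> reach F \<and> (v, y) \<in> reach F \<or>
    (x, v) \<in> reach F \<and> (u, y) \<in> reach F"
  using assms unfolding reach_def[of "insert {u, v} F"]
proof (induction rule: rtrancl_induct)
  case (step y z)
  then consider "{y, z} \<in> F" | "y = u" "z = v" | "y = v" "z = u"
    by (auto simp: doubleton_eq_iff)
  then show ?case
  proof cases
    case 1
    then have "(w, z) \<in> reach F" if "(w, y) \<in> reach F" for w
      using that reach_trans[OF that reach_edge] by simp
    with step.IH show ?thesis by blast
  qed (use step.IH reach_refl in auto)
qed simp

section \<open>Paths, cycles and the effect of adding one edge\<close>

lemma has_cycle_mono: "has_cycle F \<Longrightarrow> F \<subseteq> G \<Longrightarrow> has_cycle G"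
  unfolding has_cycle_def is_cycle_def by blast

text \<open>Induction along the walk: a step back to a vertex of the path cuts the path there, which
  keeps the vertices distinct as \<open>is_cycle\<close> demands.\<close>

lemma reach_obtains_path:
  assumes "(u, v) \<in> reach F"
  obtains p where "p \<noteq> []" "hd p = u" "last p = v" "distinct p"
    "\<And>i. Suc i < length p \<Longrightarrow> {p ! i, p ! Suc i} \<in> F"
proof -
  have "\<exists>p. p \<noteq> [] \<and> hd p = u \<and> last p = v \<and> distinct p \<and>
      (\<forall>i. Suc i < length p \<longrightarrow> {p ! i, p ! Suc i} \<in> F)"
    using assms unfolding reach_def
  proof (induction rule: rtrancl_induct)
    case base
    then show ?case by (intro exI[of _ "[u]"]) simp
  next
    case (step y z)
    then obtain p where p: "p \<noteq> []" "hd p = u" "last p = y" "distinct p"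
      "\<forall>i. Suc i < length p \<longrightarrow> {p ! i, p ! Suc i} \<in> F" by blast
    show ?case
    proof (cases "z \<in> set p")
      case True
      then obtain k where k: "k < length p" "p ! k = z"
        by (auto simp: in_set_conv_nth)
      with p have "last (take (Suc k) p) = z" "hd (take (Suc k) p) = u"
        by (auto simp: take_Suc_conv_app_nth hd_append hd_conv_nth)
      with p k show ?thesis
        by (intro exI[of _ "take (Suc k) p"]) auto
    next
      case False
      have "{(p @ [z]) ! i, (p @ [z]) ! Suc i} \<in> F" if "Suc i < length (p @ [z])" for i
      proof (cases "Suc i < length p")
        case True
        with p show ?thesis by (simp add: nth_append)
      next
        case False
        with that have "i = length p - 1" by simp
        with p step.hyps show ?thesis
          by (auto simp: nth_append last_conv_nth)
      qed
      with p False show ?thesis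
        by (intro exI[of _ "p @ [z]"]) auto
    qed
  qed
  with that show ?thesis by blast
qed

lemma has_cycle_insert_if_reach:
  assumes "(u, v) \<in> reach F" "u \<noteq> v" "{u, v} \<notin> F"
  shows "has_cycle (insert {u, v} F)"
proof -
  obtain p where p: "p \<noteq> []" "hd p = u" "last p = v" "distinct p"
    "\<And>i. Suc i < length p \<Longrightarrow> {p ! i, p ! Suc i} \<in> F"
    using reach_obtains_path[OF assms(1)] by blast
  have uv: "p ! 0 = u" "p ! (length p - 1) = v"
    using p by (auto simp: hd_conv_nth last_conv_nth)
  \<comment> \<open>Length 1 would give \<open>u = v\<close>, and length 2 would put
    \<open>{u, v}\<close> into \<open>F\<close>; hence the closed path is long enough for a
    cycle.\<close>
  have "length p \<noteq> 0" "length p \<noteq> 1" "length p \<noteq> 2"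
    using p(1) uv p(5)[of 0] assms by auto
  then have len: "3 \<le> length p" by linarith
  have "{p ! i, p ! (Suc i mod length p)} \<in> insert {u, v} F" if "i < length p" for i
  proof (cases "Suc i < length p")
    case True
    with p show ?thesis by simp
  next
    case False
    with that have "Suc i = length p" "i = length p - 1" by simp_all
    with uv show ?thesis by (simp add: insert_commute)
  qed
  with len p show ?thesis
    unfolding has_cycle_def is_cycle_def by blast
qed

text \<open>Allows any chosen edge of a cycle to be moved to the closing position, from the last
  vertex to the first.\<close>

lemma is_cycle_rotate:
  assumes "is_cycle F p"
  shows "is_cycle F (rotate k p)"
proof -
  have "{rotate k p ! i, rotate k p ! (Suc i mod length p)} \<in> F" if "i < length p" for i
  proof -
    have "0 < length p" using that by linarith
    then have "rotate k p ! (Suc i mod length p) = p ! (Suc ((k + i) mod length p) mod length p)"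
      "(k + i) mod length p < length p"
      by (simp_all add: nth_rotate mod_simps)
    with assms that show ?thesis
      by (simp add: is_cycle_def nth_rotate)
  qed
  with assms show ?thesis
    by (simp add: is_cycle_def)
qed

lemma reach_nth:
  assumes "\<And>j. j < i \<Longrightarrow> {q ! j, q ! Suc j} \<in> F"
  shows "(q ! 0, q ! i) \<in> reach F"
  using assms
proof (induction i)
  case (Suc i)
  then have "(q ! 0, q ! i) \<in> reach F" "{q ! i, q ! Suc i} \<in> F"
    by auto
  then show ?case
    by (blast intro: reach_trans reach_edge)
qed simp

text \<open>A cycle must pass through the new edge. Once rotated so that this edge closes it, the
  rest of the cycle joins \<open>u\<close> and \<open>v\<close> inside \<open>F\<close>.\<close>

lemma not_has_cycle_insert:
  assumes "\<not> has_cycle F" "(u, v) \<notin> reach F"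
  shows "\<not> has_cycle (insert {u, v} F)"
proof
  assume "has_cycle (insert {u, v} F)"
  then obtain p where p: "is_cycle (insert {u, v} F) p"
    by (auto simp: has_cycle_def)
  with assms(1) obtain i where i: "i < length p" "{p ! i, p ! (Suc i mod length p)} = {u, v}"
    unfolding has_cycle_def is_cycle_def by blast
  define l where "l = length p"
  define q where "q = rotate (Suc i) p"
  have q: "is_cycle (insert {u, v} F) q" "length q = l"
    using is_cycle_rotate[OF p, of "Suc i"] by (simp_all add: q_def l_def del: rotate_Suc)
  then have l: "3 \<le> l" and dist: "distinct q" by (auto simp: is_cycle_def)
  have "q ! (l - 1) = p ! i" "q ! 0 = p ! (Suc i mod l)"
  proof -
    have "p \<noteq> []" using i by auto
    have "Suc i + (l - 1) = i + l" using l by simp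
    then show "q ! (l - 1) = p ! i"
      using i l nth_rotate[of "l - 1" p "Suc i"] by (simp add: q_def l_def del: rotate_Suc)
    show "q ! 0 = p ! (Suc i mod l)"
      using nth_rotate[of 0 p "Suc i"] \<open>p \<noteq> []\<close> by (simp add: q_def l_def del: rotate_Suc)
  qed
  with i have ends: "{q ! (l - 1), q ! 0} = {u, v}" by (simp add: l_def)
  have "{q ! j, q ! Suc j} \<in> F" if "j < l - 1" for j
  proof -
    have "{q ! j, q ! Suc j} \<in> insert {u, v} F"
      using q that unfolding is_cycle_def
      by (metis Suc_lessD less_diff_conv mod_less Suc_eq_plus1)
    \<comment> \<open>The vertices are distinct and there are at least three of them, so the closing
      edge does not occur a second time.\<close>
    moreover have "{q ! j, q ! Suc j} \<noteq> {q ! (l - 1), q ! 0}"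
      using that l dist q(2) by (auto simp: doubleton_eq_iff nth_eq_iff_index_eq)
    ultimately show ?thesis using ends by auto
  qed
  then have "(q ! 0, q ! (l - 1)) \<in> reach F"
    by (rule reach_nth)
  with ends assms(2) show False
    by (metis doubleton_eq_iff reach_sym)
qed

section \<open>Counting components\<close>

definition components :: "'a set \<Rightarrow> 'a set set \<Rightarrow> 'a set set" where
  "components V F = (\<lambda>v. reach F `` {v}) ` V"

lemma finite_components: "finite V \<Longrightarrow> finite (components V F)"
  by (simp add: components_def)

lemma components_eq_Image:
  assumes "F \<subseteq> G"
  shows "components V G = (\<lambda>C. reach G `` C) ` components V F"
  unfolding components_def image_image reach_Image_Image[OF assms] ..

text \<open>The map from old to new components is onto and identifies the distinct classes of
  \<open>u\<close> and \<open>v\<close>.\<close>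

lemma card_components_insert_less:
  assumes "finite V" "u \<in> V" "v \<in> V" "(u, v) \<notin> reach F"
  shows "card (components V (insert {u, v} F)) < card (components V F)"
proof -
  let ?G = "insert {u, v} F" and ?f = "\<lambda>C. reach (insert {u, v} F) `` C"
  have im: "components V ?G = ?f ` components V F"
    by (rule components_eq_Image) auto
  have uv: "reach F `` {u} \<noteq> reach F `` {v}"
    using assms by (simp add: reach_Image_eq_iff)
  have "?f (reach F `` {w}) = reach ?G `` {w}" for w
    by (rule reach_Image_Image) auto
  moreover have "reach ?G `` {u} = reach ?G `` {v}"
    by (simp add: reach_Image_eq_iff reach_edge)
  ultimately have "?f (reach F `` {u}) = ?f (reach F `` {v})"
    by simp
  moreover have "reach F `` {u} \<in> components V F" "reach F `` {v} \<in> components V F"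
    using assms by (auto simp: components_def)
  ultimately have "\<not> inj_on ?f (components V F)"
    using uv by (meson inj_onD)
  then have "card (?f ` components V F) \<noteq> card (components V F)"
    using eq_card_imp_inj_on finite_components[OF assms(1)] by blast
  with card_image_le[OF finite_components[OF assms(1)], of ?f F] show ?thesis
    by (simp add: im)
qed

text \<open>The map from old to new components is injective away from the class of \<open>u\<close>,
  because every merger caused by the new edge involves that class.\<close>

lemma card_components_le_insert:
  assumes "finite V"
  shows "card (components V F) \<le> Suc (card (components V (insert {u, v} F)))"
proof -
  let ?G = "insert {u, v} F" and ?f = "\<lambda>C. reach (insert {u, v} F) `` C"
  let ?K = "components V F - {reach F `` {u}}"
  have f: "?f (reach F `` {w}) = reach ?G `` {w}" for w
    by (rule reach_Image_Image) auto
  have "inj_on ?f ?K"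
  proof (rule inj_onI)
    fix C D assume "C \<in> ?K" "D \<in> ?K" "?f C = ?f D"
    then obtain x y where CD: "C = reach F `` {x}" "D = reach F `` {y}"
      unfolding components_def by blast
    with \<open>C \<in> ?K\<close> \<open>D \<in> ?K\<close> \<open>?f C = ?f D\<close>
    have xy: "(x, u) \<notin> reach F" "(y, u) \<notin> reach F" "(x, y) \<in> reach ?G"
      unfolding CD f by (metis DiffD2 insertI1 reach_Image_eq_iff)+
    then have "(x, y) \<in> reach F"
      using reach_insertD[of x y u v F] reach_sym[of u y F] by blast
    with CD show "C = D" by (simp add: reach_Image_eq_iff)
  qed
  moreover have "?f ` ?K \<subseteq> components V ?G"
    using components_eq_Image[of F ?G V] by (auto simp del: Image_singleton_iff)
  ultimately have "card ?K \<le> card (components V ?G)"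
    by (rule card_inj_on_le[OF _ _ finite_components[OF assms]])
  then show ?thesis
    using card_Diff_singleton_if[of "components V F" "reach F `` {u}"]
    by (auto split: if_splits)
qed

lemma card_components_empty:
  fixes V :: "'a set"
  shows "card (components V {}) = card V"
proof -
  have "reach ({} :: 'a set set) = Id" by (simp add: reach_def)
  then show ?thesis by (simp add: components_def card_image)
qed

text \<open>Adding the missing edges one by one lowers the number of components each time, as no
  cycle arises, and at least one component remains at the end.\<close>

lemma spanning_tree_edges_le_components:
  assumes V: "finite V" and T: "finite T" "\<not> has_cycle T" "V \<noteq> {}"
    and edge: "\<And>e. e \<in> T \<Longrightarrow> \<exists>u\<in>V. \<exists>v\<in>V. u \<noteq> v \<and> e = {u, v}"
    and F: "F \<subseteq> T"
  shows "Suc (card (T - F)) \<le> card (components V F)"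
proof -
  have "finite (T - F)" using T by simp
  \<comment> \<open>Tying \<open>F\<close> to \<open>D\<close> by \<open>F = T - D\<close> makes the
    induction on missing edges move one edge at a time from \<open>D\<close> into the
    forest.\<close>
  moreover have "D \<subseteq> T \<Longrightarrow> D \<inter> F = {} \<Longrightarrow> F = T - D \<Longrightarrow> Suc (card D) \<le> card (components V F)"
    if "finite D" for D F
    using that
  proof (induction D arbitrary: F rule: finite_induct)
    case empty
    have "components V F \<noteq> {}" using T by (auto simp: components_def)
    then show ?case
      using finite_components[OF V] by (simp add: Suc_le_eq card_gt_0_iff)
  next
    case (insert e D)
    then obtain u v where uv: "u \<in> V" "v \<in> V" "u \<noteq> v" "e = {u, v}"
      using edge[of e] by auto
    have "insert e F = T - D" using insert by auto
    with insert.IH insert.prems insert.hyps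
    have "Suc (card D) \<le> card (components V (insert e F))" by auto
    also have "(u, v) \<notin> reach F"
    proof
      assume "(u, v) \<in> reach F"
      then have "has_cycle (insert e F)"
        using has_cycle_insert_if_reach[of u v F] uv insert.prems by auto
      with T insert.prems show False
        using has_cycle_mono[of "insert e F" T] by auto
    qed
    then have "card (components V (insert e F)) < card (components V F)"
      using card_components_insert_less[OF V uv(1,2), of F] uv(4) by simp
    finally show ?case using insert.hyps by simp
  qed
  ultimately show ?thesis using F by (metis Diff_disjoint Diff_subset double_diff inf_commute order_refl)
qed

text \<open>Starting from isolated vertices, each edge removes at most one component.\<close>

lemma card_le_components_plus_edges:
  assumes V: "finite V" and F: "finite F" "\<And>e. e \<in> F \<Longrightarrow> \<exists>u v. e = {u, v}"
  shows "card V \<le> card (components V F) + card F"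
  using F
proof (induction F rule: finite_induct)
  case empty
  then show ?case by (simp add: card_components_empty)
next
  case (insert e F)
  then obtain u v where "e = {u, v}" by blast
  with insert card_components_le_insert[OF V, of F u v] show ?case
    by simp
qed

text \<open>Connectedness leaves a single component, which bounds the vertices from above;
  acyclicity, applied with the empty forest, bounds them from below.\<close>

lemma card_spanning_tree:
  assumes "finite V" "V \<noteq> {}" "finite E" "spanning_tree V E T"
    and edge: "\<And>e. e \<in> E \<Longrightarrow> \<exists>u\<in>V. \<exists>v\<in>V. u \<noteq> v \<and> e = {u, v}"
  shows "card V = Suc (card T)"
proof -
  have T: "T \<subseteq> E" "\<not> has_cycle T" "connected_graph V T" "finite T"
    using assms by (auto simp: spanning_tree_def intro: finite_subset)
  have edgeT: "\<exists>u\<in>V. \<exists>v\<in>V. u \<noteq> v \<and> e = {u, v}" if "e \<in> T" for e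
    using edge T(1) that by blast
  obtain r where r: "r \<in> V" using \<open>V \<noteq> {}\<close> by blast
  have "components V T \<subseteq> {reach T `` {r}}"
  proof
    fix C assume "C \<in> components V T"
    then obtain v where "v \<in> V" "C = reach T `` {v}" by (auto simp: components_def)
    moreover from this T r have "(v, r) \<in> reach T"
      by (simp add: connected_graph_def reach_def)
    ultimately show "C \<in> {reach T `` {r}}"
      by (simp add: reach_Image_eq_iff)
  qed
  then have "card (components V T) \<le> card {reach T `` {r}}"
    by (intro card_mono) auto
  moreover have "card V \<le> card (components V T) + card T"
    using edgeT by (intro card_le_components_plus_edges assms T) blast
  moreover have "Suc (card (T - {})) \<le> card (components V {})"
    using edgeT by (rule spanning_tree_edges_le_components[OF assms(1) T(4,2) assms(2)]) auto
  ultimately show ?thesis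
    by (simp add: card_components_empty)
qed

text \<open>The vertex of largest height in a component is not joined to its successor inside that component.\<close>

lemma card_components_le_border:
  fixes h :: "'a \<Rightarrow> nat"
  assumes V: "finite V" and h: "\<And>v. h v < h (s v)"
  shows "card (components V F) \<le>
    card {v \<in> V. s v \<notin> V} + card {v \<in> V. s v \<in> V \<and> (v, s v) \<notin> reach F}"
proof -
  have "\<exists>x. x \<in> C \<inter> V \<and> (\<forall>w \<in> C \<inter> V. h w \<le> h x)" if "C \<in> components V F" for C
  proof -
    have "finite (h ` (C \<inter> V))" "h ` (C \<inter> V) \<noteq> {}"
      using that V by (auto simp: components_def)
    then obtain x where "x \<in> C \<inter> V" "h x = Max (h ` (C \<inter> V))"
      using Max_in by (metis imageE)
    then show ?thesis
      using \<open>finite (h ` (C \<inter> V))\<close> by (intro exI[of _ x]) auto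
  qed
  then obtain r where
    r: "\<And>C. C \<in> components V F \<Longrightarrow> r C \<in> C \<inter> V \<and> (\<forall>w \<in> C \<inter> V. h w \<le> h (r C))"
    by metis
  have comp_eq: "C = reach F `` {w}" if "C \<in> components V F" "w \<in> C" for C w
  proof -
    from that obtain v where "C = reach F `` {v}" "(v, w) \<in> reach F"
      by (auto simp: components_def)
    then show ?thesis by (simp add: reach_Image_eq_iff)
  qed
  \<comment> \<open>A component is the class of any of its members, so its chosen highest vertex
    determines it.\<close>
  have "inj_on r (components V F)"
    using r comp_eq by (intro inj_onI) (metis IntE)
  then have "card (components V F) = card (r ` components V F)"
    by (simp add: card_image)
  also have "\<dots> \<le> card ({v \<in> V. s v \<notin> V} \<union> {v \<in> V. s v \<in> V \<and> (v, s v) \<notin> reach F})"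
  proof (intro card_mono)
    show "r ` components V F \<subseteq> {v \<in> V. s v \<notin> V} \<union> {v \<in> V. s v \<in> V \<and> (v, s v) \<notin> reach F}"
    proof
      fix x assume "x \<in> r ` components V F"
      then obtain C where C: "C \<in> components V F" "x = r C" by blast
      with r[of C] comp_eq[of C x] h[of x] show
        "x \<in> {v \<in> V. s v \<notin> V} \<union> {v \<in> V. s v \<in> V \<and> (v, s v) \<notin> reach F}"
        by force
    qed
  qed (use V in auto)
  also have "\<dots> \<le> card {v \<in> V. s v \<notin> V} + card {v \<in> V. s v \<in> V \<and> (v, s v) \<notin> reach F}"
    by (rule card_Un_le)
  finally show ?thesis .
qed

section \<open>Bounds for an arbitrary graph\<close>

lemma prob_MST_eq:
  assumes "finite E"
  shows "prob_MST E T = card {es \<in> permutations_of_set E. kruskal es = T} / fact (card E)"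
proof -
  have "permutations_of_set E \<inter> {es. kruskal es = T} = {es \<in> permutations_of_set E. kruskal es = T}"
    by blast
  with assms show ?thesis
    unfolding prob_MST_def by (simp add: measure_pmf_of_set)
qed

section \<open>The greedy run on a list of edges, and the two bounds it yields\<close>

lemma kruskal_step_acyclic: "\<not> has_cycle (insert e F) \<Longrightarrow> kruskal_step F e = insert e F"
  by (simp add: kruskal_step_def)

lemma foldl_kruskal_acyclic:
  "\<not> has_cycle (F \<union> set es) \<Longrightarrow> foldl kruskal_step F es = F \<union> set es"
proof (induction es arbitrary: F)
  case (Cons e es)
  have "\<not> has_cycle (insert e F)"
    using Cons.prems has_cycle_mono[of "insert e F" "F \<union> set (e # es)"] by auto
  with Cons show ?case by (simp add: kruskal_step_acyclic)
qed simp

lemma foldl_kruskal_maximal: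
  "(\<And>e. e \<in> set es \<Longrightarrow> has_cycle (insert e F)) \<Longrightarrow> foldl kruskal_step F es = F"
  by (induction es) (auto simp: kruskal_step_def)

lemma subset_foldl_kruskal: "F \<subseteq> foldl kruskal_step F es"
proof (induction es arbitrary: F)
  case (Cons e es)
  have "F \<subseteq> kruskal_step F e" by (auto simp: kruskal_step_def)
  with Cons[of "kruskal_step F e"] show ?case by simp
qed simp

lemma prob_MST_ge:
  assumes "finite E" "spanning_tree V E T"
    and edge: "\<And>e. e \<in> E \<Longrightarrow> \<exists>u\<in>V. \<exists>v\<in>V. u \<noteq> v \<and> e = {u, v}"
  shows "1 / 2 ^ card E \<le> prob_MST E T"
proof -
  have T: "T \<subseteq> E" "\<not> has_cycle T" "connected_graph V T" "finite T"
    using assms by (auto simp: spanning_tree_def intro: finite_subset)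
  let ?P = "permutations_of_set T \<times> permutations_of_set (E - T)"
  \<comment> \<open>\<open>T\<close> already joins the ends of every other edge, so after
    \<open>T\<close> is complete everything else is rejected.\<close>
  have cyc: "has_cycle (insert e T)" if "e \<in> E - T" for e
  proof -
    from edge that obtain u v where "u \<in> V" "v \<in> V" "u \<noteq> v" "e = {u, v}" by blast
    with T that show ?thesis
      by (auto intro!: has_cycle_insert_if_reach simp: connected_graph_def reach_def)
  qed
  have "xs @ ys \<in> permutations_of_set E" "kruskal (xs @ ys) = T"
    if "xs \<in> permutations_of_set T" "ys \<in> permutations_of_set (E - T)" for xs ys
  proof -
    have xs: "set xs = T" "distinct xs" and ys: "set ys = E - T" "distinct ys"
      using that by (simp_all add: permutations_of_set_def)
    then show "xs @ ys \<in> permutations_of_set E"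
      using T by (auto simp: permutations_of_set_def)
    show "kruskal (xs @ ys) = T"
      using foldl_kruskal_acyclic[of "{}" xs] foldl_kruskal_maximal[of ys T] T cyc xs ys
      by (simp add: kruskal_def)
  qed
  then have "(\<lambda>(xs, ys). xs @ ys) ` ?P \<subseteq> {es \<in> permutations_of_set E. kruskal es = T}"
    by auto
  \<comment> \<open>All orders of \<open>T\<close> have the same length, so the place where the
    concatenation splits can be recovered.\<close>
  moreover have "inj_on (\<lambda>(xs, ys). xs @ ys) ?P"
  proof (rule inj_onI, clarify)
    fix xs ys xs' ys'
    assume "xs \<in> permutations_of_set T" "xs' \<in> permutations_of_set T" "xs @ ys = xs' @ ys'"
    then show "xs = xs' \<and> ys = ys'"
      by (simp add: length_finite_permutations_of_set)
  qed
  ultimately have "card ?P \<le> card {es \<in> permutations_of_set E. kruskal es = T}"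
    by (intro card_inj_on_le) auto
  then have *: "fact (card T) * fact (card E - card T)
      \<le> card {es \<in> permutations_of_set E. kruskal es = T}"
    using T assms by (simp add: card_cartesian_product card_Diff_subset)
  have le: "card T \<le> card E" using T assms by (simp add: card_mono)
  have "card E choose card T \<le> 2 ^ card E"
    by (rule binomial_le_pow2)
  then have "1 / 2 ^ card E \<le> 1 / real (card E choose card T)"
    using le of_nat_mono[of "card E choose card T" "2 ^ card E", where ?'a = real]
    by (intro divide_left_mono) auto
  also have "\<dots> = real (fact (card T) * fact (card E - card T)) / fact (card E)"
    using le by (simp add: binomial_fact)
  also have "\<dots> \<le> prob_MST E T"
    unfolding prob_MST_eq[OF assms(1)] using * by (intro divide_right_mono of_nat_mono) auto
  finally show ?thesis .
qed

text \<open>\<open>b j\<close> is a lower bound for the number of acceptable edges while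
  \<open>j\<close> edges of \<open>T\<close> are missing. Only those \<open>j\<close> edges keep the
  run on course, so each acceptance costs a factor \<open>j / b j\<close>. Counting orders takes the
  place of conditional probabilities.\<close>

lemma prob_MST_le:
  fixes b :: "nat \<Rightarrow> nat" and E T :: "'a set set"
  defines "cross F \<equiv> {e \<in> E - F. \<not> has_cycle (insert e F)}"
  assumes E: "finite E" and T: "T \<subseteq> E" "\<not> has_cycle T"
    and b: "\<And>j. 0 < j \<Longrightarrow> 0 < b j"
    and cross: "\<And>F. F \<subset> T \<Longrightarrow> b (card (T - F)) \<le> card (cross F)"
  shows "prob_MST E T \<le> (\<Prod>j = 1..card T. j / b j)"
proof -
  define B where "B t = (\<Prod>j = 1..t. j / b j)" for t
  have B_nonneg: "0 \<le> B t" for t by (simp add: B_def prod_nonneg)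
  have B_Suc: "Suc t * B t = b (Suc t) * B (Suc t)" for t
    using b[of "Suc t"] by (simp add: B_def)
  \<comment> \<open>The orders of the remaining edges \<open>D\<close> that extend the current
    forest \<open>F\<close> to exactly \<open>T\<close>.\<close>
  define N where "N F D = {es \<in> permutations_of_set D. foldl kruskal_step F es = T}" for F D
  have N_fin: "finite (N F D)" for F D by (simp add: N_def)
  \<comment> \<open>The invariant \<open>cross F \<subseteq> D\<close> says that no acceptable edge
    has been passed over: every edge of \<open>E\<close> already processed lies in \<open>F\<close>
    or closes a cycle with it.\<close>
  have bound: "card (N F D) \<le> fact (card D) * B (card (T - F))"
    if "D \<subseteq> E" "F \<subseteq> T" "cross F \<subseteq> D" for F D
    using that
  proof (induction "card D" arbitrary: F D)
    case 0
    then have "D = {}" using E by (simp add: finite_subset)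
    \<comment> \<open>With nothing left to process the invariant leaves no acceptable edge, whereas
      a proper subset of \<open>T\<close> has at least \<open>b\<close> of them, a positive
      number.\<close>
    have "F = T"
    proof (rule ccontr)
      assume "F \<noteq> T"
      with 0 \<open>D = {}\<close> have "card (T - F) \<noteq> 0" "card (cross F) = 0"
        using T E by (auto simp: finite_subset)
      with cross[of F] b[of "card (T - F)"] \<open>F \<noteq> T\<close> 0 show False by auto
    qed
    have "card (N F D) \<le> card (permutations_of_set D)"
      unfolding N_def by (intro card_mono) auto
    with \<open>F = T\<close> \<open>D = {}\<close> show ?case by (simp add: B_def)
  next
    case (Suc d)
    have fD: "finite D" using Suc E finite_subset by blast
    show ?case
    proof (cases "F = T")
      case True
      have "card (N F D) \<le> card (permutations_of_set D)"
        unfolding N_def by (intro card_mono) auto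
      with True fD show ?thesis
        by (simp add: B_def) (metis of_nat_fact of_nat_le_iff)
    next
      case False
      obtain t where t: "card (T - F) = Suc t"
      proof -
        have "finite (T - F)" "T - F \<noteq> {}"
          using False Suc.prems T E by (auto intro: finite_subset)
        with that show ?thesis
          by (metis card_0_eq not0_implies_Suc)
      qed
      \<comment> \<open>The bound for the orders that begin with one given rejected edge: the forest
        is unchanged and \<open>d\<close> edges remain.\<close>
      define c where "c = fact d * B (Suc t)"
      have TF: "T - F \<subseteq> cross F"
      proof
        fix e assume e: "e \<in> T - F"
        with Suc.prems have "insert e F \<subseteq> T" by auto
        with e T has_cycle_mono[of "insert e F" T] show "e \<in> cross F"
          by (auto simp: cross_def)
      qed
      have fin: "finite (cross F)" using E by (simp add: cross_def)
      have split: "N F D = (\<Union>e\<in>D. (#) e ` N (kruskal_step F e) (D - {e}))"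
      proof -
        have "D \<noteq> {}" using Suc.hyps by auto
        then show ?thesis
          unfolding N_def by (subst permutations_of_set_nonempty) auto
      qed
      have "card (N F D) \<le> (\<Sum>e\<in>D. card ((#) e ` N (kruskal_step F e) (D - {e})))"
        unfolding split using fD by (rule card_UN_le)
      also have "\<dots> = (\<Sum>e\<in>D. card (N (kruskal_step F e) (D - {e})))"
        by (intro sum.cong refl card_image) simp
      also have "\<dots> = (\<Sum>e\<in>D - cross F. card (N (kruskal_step F e) (D - {e})))
          + (\<Sum>e\<in>cross F. card (N (kruskal_step F e) (D - {e})))"
        using fD Suc.prems by (intro sum.subset_diff) auto
      also have "(\<Sum>e\<in>cross F. card (N (kruskal_step F e) (D - {e})))
          = (\<Sum>e\<in>T - F. card (N (kruskal_step F e) (D - {e})))"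
      proof (intro sum.mono_neutral_right fin TF ballI)
        \<comment> \<open>An accepted edge is never removed, so accepting one outside
          \<open>T\<close> rules out the outcome \<open>T\<close>.\<close>
        fix e assume e: "e \<in> cross F - (T - F)"
        then have "e \<notin> T" "e \<in> kruskal_step F e"
          by (auto simp: cross_def kruskal_step_acyclic)
        then have "N (kruskal_step F e) (D - {e}) = {}"
          using subset_foldl_kruskal by (fastforce simp: N_def)
        then show "card (N (kruskal_step F e) (D - {e})) = 0" by simp
      qed
      finally have "real (card (N F D)) \<le>
          real ((\<Sum>e\<in>D - cross F. card (N (kruskal_step F e) (D - {e}))) +
            (\<Sum>e\<in>T - F. card (N (kruskal_step F e) (D - {e}))))"
        by (rule of_nat_mono)
      also have "\<dots> = (\<Sum>e\<in>D - cross F. real (card (N (kruskal_step F e) (D - {e})))) +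
          (\<Sum>e\<in>T - F. real (card (N (kruskal_step F e) (D - {e}))))"
        by simp
      also have "\<dots> \<le> (\<Sum>e\<in>D - cross F. c) + (\<Sum>e\<in>T - F. fact d * B t)"
      proof (intro add_mono sum_mono)
        fix e assume e: "e \<in> D - cross F"
        then have "kruskal_step F e = F"
          using Suc.prems by (auto simp: cross_def kruskal_step_def)
        moreover have "card (N F (D - {e})) \<le> fact (card (D - {e})) * B (card (T - F))"
          using e Suc.prems Suc.hyps(2) fD by (intro Suc.hyps(1)) auto
        ultimately show "card (N (kruskal_step F e) (D - {e})) \<le> c"
          using e fD t Suc.hyps(2)[symmetric] by (simp add: c_def)
      next
        fix e assume e: "e \<in> T - F"
        then have e': "e \<in> D" "\<not> has_cycle (insert e F)"
          using TF Suc.prems by (auto simp: cross_def)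
        \<comment> \<open>Cycles persist when the forest grows, so rejected edges stay rejected and
          the invariant survives.\<close>
        have "cross (insert e F) \<subseteq> D - {e}"
        proof -
          have "has_cycle (insert x (insert e F))" if "has_cycle (insert x F)" for x
            using that by (rule has_cycle_mono) auto
          then have "cross (insert e F) \<subseteq> cross F - {e}"
            by (auto simp: cross_def)
          then show ?thesis using Suc.prems by blast
        qed
        then have "card (N (insert e F) (D - {e})) \<le> fact (card (D - {e})) * B (card (T - insert e F))"
          using e e' Suc.prems Suc.hyps(2) fD by (intro Suc.hyps(1)) auto
        moreover have "card (T - insert e F) = t"
        proof -
          have "T - insert e F = T - F - {e}" by auto
          with e t show ?thesis by (simp only: card_Diff_singleton diff_Suc_1)
        qed
        ultimately show "card (N (kruskal_step F e) (D - {e})) \<le> fact d * B t"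
          using e' fD Suc.hyps(2)[symmetric] by (simp add: kruskal_step_acyclic)
      qed
      \<comment> \<open>Each rejected first edge contributes \<open>c\<close>. The tree edges
        contribute \<open>b (Suc t) * c\<close> together, at most \<open>c\<close> for each
        acceptable edge, so the total is at most \<open>c\<close> per edge of
        \<open>D\<close>.\<close>
      also have "\<dots> = (card D - card (cross F)) * c + fact d * (Suc t * B t)"
        using fin Suc.prems t by (simp add: card_Diff_subset)
      also have "fact d * (Suc t * B t) = b (Suc t) * c"
        unfolding B_Suc by (simp add: c_def)
      also have "b (Suc t) * c \<le> card (cross F) * c"
        using cross[of F] t False Suc.prems B_nonneg
        by (intro mult_right_mono) (auto simp: c_def)
      also have "(card D - card (cross F)) * c + card (cross F) * c = card D * c"
        using card_mono[OF fD Suc.prems(3)] by (simp add: of_nat_diff algebra_simps)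
      also have "\<dots> = fact (card D) * B (card (T - F))"
        using Suc.hyps(2)[symmetric] t by (simp add: c_def)
      finally show ?thesis by simp
    qed
  qed
  have "card (N {} E) \<le> fact (card E) * B (card T)"
    using bound[of E "{}"] by (auto simp: cross_def)
  then show ?thesis
    unfolding prob_MST_eq[OF E] N_def kruskal_def B_def
    by (simp add: divide_le_eq mult.commute)
qed

section \<open>The grid\<close>

lemma grid_dist_iff:
  "dist (real a, real b) (real c, real d) = 1 \<longleftrightarrow>
     (b = d \<and> (c = Suc a \<or> a = Suc c)) \<or> (a = c \<and> (d = Suc b \<or> b = Suc d))"
proof -
  have "dist (real a, real b) (real c, real d) = 1 \<longleftrightarrow>
      (real a - real c)\<^sup>2 + (real b - real d)\<^sup>2 = 1"
    by (simp add: dist_Pair_Pair dist_real_def)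
  also have "(real a - real c)\<^sup>2 + (real b - real d)\<^sup>2 =
      of_int ((int a - int c)\<^sup>2 + (int b - int d)\<^sup>2)"
    by simp
  also have "\<dots> = 1 \<longleftrightarrow> (int a - int c)\<^sup>2 + (int b - int d)\<^sup>2 = 1"
    by (metis of_int_1 of_int_eq_iff)
  also have "\<dots> \<longleftrightarrow> (b = d \<and> (c = Suc a \<or> a = Suc c)) \<or> (a = c \<and> (d = Suc b \<or> b = Suc d))"
    (is "_ \<longleftrightarrow> ?R")
  proof
    assume *: "(int a - int c)\<^sup>2 + (int b - int d)\<^sup>2 = 1"
    \<comment> \<open>For integers this turns the sum of squares into a bound on the sum of absolute
      values, which is linear.\<close>
    have sq: "\<bar>x\<bar> \<le> x\<^sup>2" for x :: int
      by (metis abs_ge_zero abs_le_square_iff abs_mult_self_eq int_one_le_iff_zero_less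
          linorder_not_le mult_le_cancel_right1 order_le_less power2_eq_square)
    have "\<bar>int a - int c\<bar> + \<bar>int b - int d\<bar> \<le> 1"
      using * sq[of "int a - int c"] sq[of "int b - int d"] by linarith
    moreover have "a \<noteq> c \<or> b \<noteq> d"
      using * by auto
    ultimately show ?R by linarith
  qed auto
  finally show ?thesis .
qed

text \<open>Like \<open>grid_up\<close>, a total function that may step off the grid; the border
  consists of the vertices where it does.\<close>

definition grid_right :: "nat \<times> nat \<Rightarrow> nat \<times> nat" where
  "grid_right v = (Suc (fst v), snd v)"

definition grid_up :: "nat \<times> nat \<Rightarrow> nat \<times> nat" where
  "grid_up v = (fst v, Suc (snd v))"

text \<open>Indexing each edge by its left or lower end serves the count of all edges as well as
  that of the crossing ones.\<close>

lemma grid_edges_eq: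
  "grid_edges n = (\<lambda>v. {v, grid_right v}) ` {v \<in> grid_verts n. grid_right v \<in> grid_verts n} \<union>
     (\<lambda>v. {v, grid_up v}) ` {v \<in> grid_verts n. grid_up v \<in> grid_verts n}" (is "_ = ?R")
proof
  show "grid_edges n \<subseteq> ?R"
  proof
    fix e assume "e \<in> grid_edges n"
    then obtain a b c d where e: "e = {(a, b), (c, d)}"
      and V: "(a, b) \<in> grid_verts n" "(c, d) \<in> grid_verts n"
      and d: "dist (real a, real b) (real c, real d) = 1"
      unfolding grid_edges_def by blast
    from d consider "b = d" "c = Suc a" | "b = d" "a = Suc c" | "a = c" "d = Suc b" | "a = c" "b = Suc d"
      unfolding grid_dist_iff by blast
    then show "e \<in> ?R"
    proof cases
      case 1
      with e V show ?thesis by (intro UnI1 image_eqI[of _ _ "(a, b)"]) (auto simp: grid_right_def)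
    next
      case 2
      with e V show ?thesis by (intro UnI1 image_eqI[of _ _ "(c, d)"]) (auto simp: grid_right_def)
    next
      case 3
      with e V show ?thesis by (intro UnI2 image_eqI[of _ _ "(a, b)"]) (auto simp: grid_up_def)
    next
      case 4
      with e V show ?thesis by (intro UnI2 image_eqI[of _ _ "(c, d)"]) (auto simp: grid_up_def)
    qed
  qed
  show "?R \<subseteq> grid_edges n"
    unfolding grid_edges_def grid_dist_iff by (fastforce simp: grid_right_def grid_up_def)
qed

lemma finite_grid_verts: "finite (grid_verts n)"
  by (simp add: grid_verts_def)

lemma card_grid_verts: "card (grid_verts n) = n\<^sup>2"
  by (simp add: grid_verts_def power2_eq_square)

lemma grid_edge_ends:
  assumes "e \<in> grid_edges n"
  shows "\<exists>u\<in>grid_verts n. \<exists>v\<in>grid_verts n. u \<noteq> v \<and> e = {u, v}"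
proof -
  have "v \<noteq> grid_right v" "v \<noteq> grid_up v" for v
    by (simp_all add: grid_right_def grid_up_def prod_eq_iff)
  with assms show ?thesis
    unfolding grid_edges_eq by blast
qed

lemma card_grid_edges: "card (grid_edges n) \<le> 2 * n\<^sup>2"
proof -
  have "card (f ` {v \<in> grid_verts n. P v}) \<le> n\<^sup>2" for f :: "nat \<times> nat \<Rightarrow> (nat \<times> nat) set" and P
  proof -
    have "card (f ` {v \<in> grid_verts n. P v}) \<le> card {v \<in> grid_verts n. P v}"
      by (intro card_image_le) (simp add: finite_grid_verts)
    also have "\<dots> \<le> card (grid_verts n)"
      by (intro card_mono finite_grid_verts) auto
    finally show ?thesis by (simp add: card_grid_verts)
  qed
  then show ?thesis
    unfolding grid_edges_eq mult_2 by (intro order.trans[OF card_Un_le] add_mono)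
qed

section \<open>Border vertices and crossing edges of the grid\<close>

lemma card_grid_border:
  "card {v \<in> grid_verts n. grid_right v \<notin> grid_verts n} \<le> n"
  "card {v \<in> grid_verts n. grid_up v \<notin> grid_verts n} \<le> n"
proof -
  have "{v \<in> grid_verts n. grid_right v \<notin> grid_verts n} \<subseteq> {n} \<times> {1..n}"
    "{v \<in> grid_verts n. grid_up v \<notin> grid_verts n} \<subseteq> {1..n} \<times> {n}"
    by (auto simp: grid_verts_def grid_right_def grid_up_def)
  then show "card {v \<in> grid_verts n. grid_right v \<notin> grid_verts n} \<le> n"
    "card {v \<in> grid_verts n. grid_up v \<notin> grid_verts n} \<le> n"
    using card_mono[of "{n} \<times> {1..n}"] card_mono[of "{1..n} \<times> {n}"] by force+
qed

text \<open>The border estimate is used twice, with the coordinates \<open>fst\<close> and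
  \<open>snd\<close> as heights. Each direction loses at most \<open>n\<close> border vertices, and
  horizontal and vertical edges are disjoint.\<close>

lemma card_crossing_grid_edges:
  assumes "\<not> has_cycle F"
  shows "2 * card (components (grid_verts n) F) \<le>
    card {e \<in> grid_edges n - F. \<not> has_cycle (insert e F)} + 2 * n"
proof -
  let ?V = "grid_verts n" and ?C = "{e \<in> grid_edges n - F. \<not> has_cycle (insert e F)}"
  define X where "X s = {v \<in> ?V. s v \<in> ?V \<and> (v, s v) \<notin> reach F}" for s
  define R where "R = (\<lambda>v. {v, grid_right v}) ` X grid_right"
  define U where "U = (\<lambda>v. {v, grid_up v}) ` X grid_up"
  have fin: "finite (X s)" for s by (simp add: X_def finite_grid_verts)
  have "card (components ?V F) \<le> n + card (X grid_right)"
    using card_components_le_border[OF finite_grid_verts, of fst grid_right n F] card_grid_border(1)[of n]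
    by (simp add: X_def grid_right_def)
  moreover have "card (components ?V F) \<le> n + card (X grid_up)"
    using card_components_le_border[OF finite_grid_verts, of snd grid_up n F] card_grid_border(2)[of n]
    by (simp add: X_def grid_up_def)
  moreover have "inj (\<lambda>v. {v, grid_right v})" "inj (\<lambda>v. {v, grid_up v})"
    by (auto simp: inj_def grid_right_def grid_up_def doubleton_eq_iff)
  then have "card R = card (X grid_right)" "card U = card (X grid_up)"
    unfolding R_def U_def by (auto intro!: card_image intro: inj_on_subset)
  moreover have "R \<inter> U = {}"
    by (auto simp: R_def U_def grid_right_def grid_up_def doubleton_eq_iff)
  then have "card (R \<union> U) = card R + card U"
    by (intro card_Un_disjoint) (auto simp: R_def U_def fin)
  moreover have "R \<union> U \<subseteq> ?C"
  proof -
    have "{v, s v} \<in> ?C" if "v \<in> X s" "{v, s v} \<in> grid_edges n" for v s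
      using that not_has_cycle_insert[OF assms, of v "s v"] reach_edge[of v "s v" F]
      by (auto simp: X_def)
    then show ?thesis
      unfolding R_def U_def by (auto simp: X_def grid_edges_eq)
  qed
  then have "card (R \<union> U) \<le> card ?C"
    by (intro card_mono) (simp_all add: finite_grid_edges)
  ultimately show ?thesis by linarith
qed

text \<open>For \<open>j < n\<close> the truncated difference is 0 and the factor is just
  \<open>j\<close>. The later factors have denominators \<open>2 * 1\<close>, \<open>2 * 2\<close>
  and so on, so the product is a quotient of factorials over a power of 2.\<close>

lemma prod_ratio_le:
  assumes "1 \<le> n"
  shows "(\<Prod>j = 1..n\<^sup>2 - 1. real j / real (max 1 (2 * (Suc j - n)))) \<le> (2 * real n ^ 2) ^ n / 2 ^ n\<^sup>2"
proof -
  let ?f = "\<lambda>j. real j / real (max 1 (2 * (Suc j - n)))"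
  define a where "a = n - 1"
  have n: "n = Suc a" using assms by (simp add: a_def)
  have step: "(\<Prod>j = 1..a + i. ?f j) = fact (a + i) / (2 ^ i * fact i)" for i
  proof (induction i)
    case 0
    have "(\<Prod>j = 1..a. ?f j) = (\<Prod>j = 1..a. real j)"
      by (intro prod.cong) (auto simp: n)
    then show ?case by (simp add: fact_prod)
  next
    case (Suc i)
    have "(\<Prod>j = 1..a + Suc i. ?f j) = (\<Prod>j = 1..a + i. ?f j) * ?f (Suc (a + i))"
      by simp
    also have "?f (Suc (a + i)) = real (Suc (a + i)) / (2 * real (Suc i))"
      by (simp add: n)
    also have "(\<Prod>j = 1..a + i. ?f j) * (real (Suc (a + i)) / (2 * real (Suc i))) =
        fact (a + Suc i) / (2 ^ Suc i * fact (Suc i))"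
      unfolding Suc by (simp add: field_simps)
    finally show ?case .
  qed
  have "n \<le> n\<^sup>2" using assms by (simp add: power2_eq_square)
  define i where "i = n\<^sup>2 - n"
  have i: "n\<^sup>2 - 1 = a + i" "n\<^sup>2 = n + i"
    using \<open>n \<le> n\<^sup>2\<close> n by (simp_all add: i_def)
  \<comment> \<open>This quotient is a product of only \<open>a = n - 1\<close> factors, hence
    subexponential in \<open>n^2\<close>.\<close>
  have "fact (a + i) div fact (a + i - a) \<le> (a + i) ^ a"
    by (rule fact_div_fact_le_pow) simp
  then have "real (fact (a + i) div fact i) \<le> real ((a + i) ^ a)"
    by (simp only: of_nat_le_iff) simp
  also have "real (fact (a + i) div fact i) = fact (a + i) / fact i"
    by (subst real_of_nat_div) (auto simp: fact_dvd)
  also have "real ((a + i) ^ a) \<le> real ((n\<^sup>2) ^ n)"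
  proof -
    have "(a + i) ^ a \<le> (n\<^sup>2) ^ a" using i by (intro power_mono) auto
    also have "\<dots> \<le> (n\<^sup>2) ^ n" using assms n by (intro power_increasing) auto
    finally show ?thesis by (rule of_nat_mono)
  qed
  finally have "fact (a + i) / fact i / 2 ^ i \<le> real ((n\<^sup>2) ^ n) / (2::real) ^ i"
    by (rule divide_right_mono) simp
  also have "\<dots> = (2 * real n ^ 2) ^ n / 2 ^ n\<^sup>2"
    by (subst i(2)) (simp add: power_mult_distrib power_add)
  finally show ?thesis
    unfolding i(1) step by (simp add: mult.commute)
qed

lemma prob_MST_grid_le:
  assumes "1 \<le> n" "spanning_tree (grid_verts n) (grid_edges n) T"
  shows "prob_MST (grid_edges n) T \<le> (2 * real n ^ 2) ^ n / 2 ^ n\<^sup>2"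
proof -
  have T: "T \<subseteq> grid_edges n" "\<not> has_cycle T" "finite T"
    using assms finite_grid_edges by (auto simp: spanning_tree_def intro: finite_subset)
  have ne: "grid_verts n \<noteq> {}" using assms by (auto simp: grid_verts_def)
  have "card (grid_verts n) = Suc (card T)"
    using grid_edge_ends
    by (intro card_spanning_tree[OF finite_grid_verts ne finite_grid_edges assms(2)]) blast
  then have card: "card T = n\<^sup>2 - 1" by (simp add: card_grid_verts)
  \<comment> \<open>The crossing estimate is void while few edges are missing. There
    \<open>max 1\<close> keeps the bound positive, justified because a missing tree edge is itself
    acceptable.\<close>
  have "max 1 (2 * (Suc (card (T - F)) - n)) \<le> card {e \<in> grid_edges n - F. \<not> has_cycle (insert e F)}"
    (is "_ \<le> card ?C") if F: "F \<subset> T" for F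
  proof -
    have acyc: "\<not> has_cycle F" using F T has_cycle_mono[of F T] by auto
    have "Suc (card (T - F)) \<le> card (components (grid_verts n) F)"
      using F T(1) grid_edge_ends
      by (intro spanning_tree_edges_le_components[OF finite_grid_verts T(3,2) ne]) auto
    with card_crossing_grid_edges[OF acyc, of n] have "2 * (Suc (card (T - F)) - n) \<le> card ?C"
      by linarith
    moreover obtain e where e: "e \<in> T" "e \<notin> F" using F by blast
    with F T has_cycle_mono[of "insert e F" T] have "e \<in> ?C" by auto
    then have "0 < card ?C" by (auto simp: card_gt_0_iff finite_grid_edges)
    ultimately show ?thesis by simp
  qed
  then have "prob_MST (grid_edges n) T \<le> (\<Prod>j = 1..card T. real j / real (max 1 (2 * (Suc j - n))))"
    using T by (intro prob_MST_le finite_grid_edges) auto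
  with prod_ratio_le[OF assms(1)] show ?thesis unfolding card by linarith
qed

lemma prob_MST_grid_ge:
  assumes "spanning_tree (grid_verts n) (grid_edges n) T"
  shows "(1 / 4) ^ n\<^sup>2 \<le> prob_MST (grid_edges n) T"
proof -
  have "(1 / 4 :: real) ^ n\<^sup>2 = 1 / 2 ^ (2 * n\<^sup>2)"
    by (simp add: power_mult power_one_over)
  also have "\<dots> \<le> 1 / 2 ^ card (grid_edges n)"
    using card_grid_edges by (intro divide_left_mono power_increasing) auto
  also have "\<dots> \<le> prob_MST (grid_edges n) T"
    using grid_edge_ends by (intro prob_MST_ge[OF finite_grid_edges assms]) blast
  finally show ?thesis .
qed

section \<open>Passage from the bounds at fixed \<open>n\<close> to the asymptotic
  statements\<close>

theorem theorem1p1: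
  fixes T :: "nat \<Rightarrow> (nat \<times> nat) set set"
  assumes "\<And>n. n \<ge> 1 \<Longrightarrow> spanning_tree (grid_verts n) (grid_edges n) (T n)"
  shows "(\<exists>\<epsilon> :: nat \<Rightarrow> real. \<epsilon> \<longlonglongrightarrow> 0 \<and>
            (\<forall>\<^sub>F n in sequentially. prob_MST (grid_edges n) (T n) \<ge> (1/4 + \<epsilon> n) ^ (n^2))) \<and>
         (\<exists>\<epsilon> :: nat \<Rightarrow> real. \<epsilon> \<longlonglongrightarrow> 0 \<and>
            (\<forall>\<^sub>F n in sequentially. prob_MST (grid_edges n) (T n) \<le> (1/2 + \<epsilon> n) ^ (n^2))) \<and>
         liminf (\<lambda>n. ereal (ln (prob_MST (grid_edges n) (T n)) / real (n^2))) \<ge> ereal (ln (1/4)) \<and>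
         limsup (\<lambda>n. ereal (ln (prob_MST (grid_edges n) (T n)) / real (n^2))) \<le> ereal (ln (1/2))"
proof (intro conjI)
  let ?p = "\<lambda>n. prob_MST (grid_edges n) (T n)"
  \<comment> \<open>Chosen so that \<open>1 / 2 + \<delta> n\<close> is exactly the
    \<open>n^2\<close>-th root of the upper bound; the error vanishes because
    \<open>(2 * n^2) powr (1 / n)\<close> tends to 1.\<close>
  define \<delta> where "\<delta> n = (2 * real n ^ 2) powr (1 / real n) / 2 - 1 / 2" for n
  have ge: "(1 / 4) ^ n\<^sup>2 \<le> ?p n" if "1 \<le> n" for n
    using assms[OF that] by (rule prob_MST_grid_ge)
  have le: "?p n \<le> (1 / 2 + \<delta> n) ^ n\<^sup>2" if "1 \<le> n" for n
  proof -
    have "((2 * real n ^ 2) powr (1 / real n)) ^ n\<^sup>2 = (((2 * real n ^ 2) powr (1 / real n)) powr real n) ^ n"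
      using that by (simp add: power2_eq_square powr_realpow power_mult)
    also have "\<dots> = (2 * real n ^ 2) ^ n"
      using that by (simp add: powr_powr)
    finally have "(2 * real n ^ 2) ^ n / 2 ^ n\<^sup>2 = (1 / 2 + \<delta> n) ^ n\<^sup>2"
      by (simp add: \<delta>_def power_divide)
    with prob_MST_grid_le[OF that assms[OF that]] show ?thesis by simp
  qed
  have \<delta>: "\<delta> \<longlonglongrightarrow> 0"
    unfolding \<delta>_def by real_asymp
  show "\<exists>\<epsilon> :: nat \<Rightarrow> real. \<epsilon> \<longlonglongrightarrow> 0 \<and> (\<forall>\<^sub>F n in sequentially. ?p n \<ge> (1/4 + \<epsilon> n) ^ (n^2))"
    \<comment> \<open>The lower bound holds without any error term.\<close>
    using ge by (intro exI[of _ "\<lambda>_. 0"] conjI eventually_sequentiallyI[of 1]) auto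
  show "\<exists>\<epsilon> :: nat \<Rightarrow> real. \<epsilon> \<longlonglongrightarrow> 0 \<and> (\<forall>\<^sub>F n in sequentially. ?p n \<le> (1/2 + \<epsilon> n) ^ (n^2))"
    using le \<delta> by (intro exI[of _ \<delta>] conjI eventually_sequentiallyI[of 1]) auto
  \<comment> \<open>Positivity allows logarithms of both bounds to be taken and compared.\<close>
  have pos: "0 < ?p n" if "1 \<le> n" for n
    using ge[OF that] by (rule less_le_trans[rotated]) simp
  have "ln (1 / 4) \<le> ln (?p n) / real (n\<^sup>2)" if "1 \<le> n" for n
  proof -
    have "real (n\<^sup>2) * ln (1 / 4) \<le> ln (?p n)"
      using ge[OF that] pos[OF that] by (subst ln_realpow[symmetric]) auto
    with that show ?thesis by (simp add: field_simps)
  qed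
  then show "ereal (ln (1/4)) \<le> liminf (\<lambda>n. ereal (ln (?p n) / real (n^2)))"
    by (intro Liminf_bounded eventually_sequentiallyI[of 1]) auto
  have "ln (?p n) / real (n\<^sup>2) \<le> ln (1 / 2 + \<delta> n)" if "1 \<le> n" for n
  proof -
    have "0 < 1 / 2 + \<delta> n" using that by (simp add: \<delta>_def)
    then have "ln (?p n) \<le> real (n\<^sup>2) * ln (1 / 2 + \<delta> n)"
      using le[OF that] pos[OF that] by (subst ln_realpow[symmetric]) auto
    with that show ?thesis by (simp add: field_simps)
  qed
  then have "limsup (\<lambda>n. ereal (ln (?p n) / real (n^2))) \<le> limsup (\<lambda>n. ereal (ln (1 / 2 + \<delta> n)))"
    by (intro Limsup_mono eventually_sequentiallyI[of 1]) auto
  also have "(\<lambda>n. ln (1 / 2 + \<delta> n)) \<longlonglongrightarrow> ln (1 / 2 + 0)"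
    by (intro tendsto_intros \<delta>) auto
  then have "limsup (\<lambda>n. ereal (ln (1 / 2 + \<delta> n))) = ereal (ln (1 / 2))"
    by (intro lim_imp_Limsup) auto
  finally show "limsup (\<lambda>n. ereal (ln (?p n) / real (n^2))) \<le> ereal (ln (1/2))" .
qed

end
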